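(* Let $p\ge 5$ be a prime, let $r$ be a positive integer that is a quadratic non-residue modulo $p$, and let $A\in\{0,1,2\}$ be such that $Ap\equiv 2r+1\pmod{3}$. Put $$R=\begin{cases} 2(Ap+r) & \text{if } 2(Ap+r)<3p,\\ 2(Ap+r)-3p & \text{if } 2(Ap+r)>3p.\end{cases}$$ Then for all integers $n\geq 0$, $$\overline{OPT}_3(3pn+R)\equiv 0\pmod{4}.$$
   Context: For a positive integer $m$ let $f_m:=(q^m;q^m)_\infty=\prod_{i\ge 1}(1-q^{mi})$ (as a formal power series in $q$). For a positive integer $k$ and integers $n\ge 0$, $\overline{OPT}_k(n)$ denotes the number of overpartition $k$-tuples of $n$ with all parts odd: $k$-tuples $(\xi_1,\dots,\xi_k)$ of overpartitions (partitions in which the first occurrence of each part size may be overlined) with all parts odd and total sum of all parts equal to $n$. Its generating function is $$\sum_{n\geq 0}\overline{OPT}_k(n)q^n=\frac{f_{2}^{3k}}{f_{1}^{2k}f_{4}^{k}}.$$ A quadratic non-residue modulo $p$ is an integer $r$ not divisible by $p$ such that $x^2\equiv r\pmod p$ has no solution. *)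

theory Defs
  imports "HOL-Number_Theory.Number_Theory" "HOL-Library.Multiset"
begin

text \<open>
  An overpartition is encoded as the multiset of its parts together with the set of those part
  sizes whose first occurrence is overlined.
\<close>

type_synonym opart = "nat multiset \<times> nat set"

definition overpartition :: "opart \<Rightarrow> bool" where
  "overpartition \<xi> \<longleftrightarrow> 0 \<notin># fst \<xi> \<and> snd \<xi> \<subseteq> set_mset (fst \<xi>)"

definition all_parts_odd :: "opart \<Rightarrow> bool" where
  "all_parts_odd \<xi> \<longleftrightarrow> (\<forall>x \<in># fst \<xi>. odd x)"

definition weight :: "opart \<Rightarrow> nat" where
  "weight \<xi> = \<Sum>\<^sub># (fst \<xi>)"

definition odd_overpartition_tuples :: "nat \<Rightarrow> nat \<Rightarrow> opart list set" where
  "odd_overpartition_tuples k n =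
     {\<xi>s. length \<xi>s = k \<and> (\<forall>\<xi> \<in> set \<xi>s. overpartition \<xi> \<and> all_parts_odd \<xi>)
          \<and> (\<Sum>\<xi>\<leftarrow>\<xi>s. weight \<xi>) = n}"

definition OPT :: "nat \<Rightarrow> nat \<Rightarrow> nat" where
  "OPT k n = card (odd_overpartition_tuples k n)"

text \<open>The set counted by \<open>OPT\<close> is finite, so \<open>card\<close> really counts it.\<close>

lemma size_le_sum_mset:
  fixes M :: "nat multiset"
  assumes "0 \<notin># M"
  shows "size M \<le> \<Sum>\<^sub># M"
  using assms by (induction M) auto

lemma finite_overpartitions_le: "finite {\<xi>. overpartition \<xi> \<and> weight \<xi> \<le> n}"
proof (rule finite_subset)
  let ?L = "{xs. set xs \<subseteq> {..n} \<and> length xs \<le> n}"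
  show "finite (mset ` ?L \<times> Pow {..n})"
    by (simp add: finite_lists_length_le)
  show "{\<xi>. overpartition \<xi> \<and> weight \<xi> \<le> n} \<subseteq> mset ` ?L \<times> Pow {..n}"
  proof
    fix \<xi> assume "\<xi> \<in> {\<xi>. overpartition \<xi> \<and> weight \<xi> \<le> n}"
    then obtain M S where \<xi>: "\<xi> = (M, S)" "0 \<notin># M" "S \<subseteq> set_mset M" "\<Sum>\<^sub># M \<le> n"
      by (cases \<xi>) (auto simp: overpartition_def weight_def)
    obtain xs where xs: "mset xs = M" using ex_mset by blast
    have "x \<le> n" if "x \<in># M" for x
      using that \<xi>(4) by (auto dest!: multi_member_split)
    moreover have "length xs \<le> n"
      using size_le_sum_mset[OF \<xi>(2)] \<xi>(4) xs by (metis order_trans size_mset)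
    ultimately show "\<xi> \<in> mset ` ?L \<times> Pow {..n}"
      using \<xi> xs by auto
  qed
qed

lemma finite_odd_overpartition_tuples: "finite (odd_overpartition_tuples k n)"
proof (rule finite_subset)
  let ?B = "{\<xi>. overpartition \<xi> \<and> weight \<xi> \<le> n}"
  show "finite {\<xi>s. set \<xi>s \<subseteq> ?B \<and> length \<xi>s = k}"
    by (rule finite_lists_length_eq[OF finite_overpartitions_le])
  show "odd_overpartition_tuples k n \<subseteq> {\<xi>s. set \<xi>s \<subseteq> ?B \<and> length \<xi>s = k}"
  proof
    fix \<xi>s assume *: "\<xi>s \<in> odd_overpartition_tuples k n"
    have "weight \<xi> \<le> n" if "\<xi> \<in> set \<xi>s" for \<xi>
      using * that member_le_sum_list[of "weight \<xi>" "map weight \<xi>s"]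
      by (simp add: odd_overpartition_tuples_def)
    with * show "\<xi>s \<in> {\<xi>s. set \<xi>s \<subseteq> ?B \<and> length \<xi>s = k}"
      by (auto simp: odd_overpartition_tuples_def)
  qed
qed

end

(* Forgetting overlines, a k-tuple of multisets of odd parts with w distinct parts in total carries
   exactly 2^w choices of overlines.  Modulo 4 only the tuples with w = 1 survive, each counted
   twice; such a tuple has a single nonempty entry, n/d copies of an odd divisor d of n.  Hence
   OPT k n is congruent to 2k times the number of odd divisors of n, and this number is even unless
   n is a square or twice a square.  The hypotheses force the argument to be 2 modulo 3, hence not a
   square, and to be 2r modulo p with r a non-residue, hence not twice a square. *)
theory Submission
  imports Defs
begin

section \<open>Forgetting overlines: \<open>OPT\<close> as a sum of powers of two\<close>

definition odd_multiset_tuples :: "nat \<Rightarrow> nat \<Rightarrow> nat multiset list set" where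
  "odd_multiset_tuples k n =
     {Ms. length Ms = k \<and> (\<forall>M \<in> set Ms. \<forall>x \<in># M. odd x) \<and> (\<Sum>M\<leftarrow>Ms. \<Sum>\<^sub># M) = n}"

text \<open>A size that occurs in several entries counts once for each of them, since the entries
  are overlined independently.\<close>

definition distinct_parts :: "nat multiset list \<Rightarrow> nat" where
  "distinct_parts Ms = (\<Sum>M\<leftarrow>Ms. card (set_mset M))"

text \<open>This is the fibre over \<open>Ms\<close> of the map that forgets overlines. Positivity
  of the parts is left to \<open>odd_multiset_tuples\<close>, where oddness excludes 0.\<close>

definition overlinings :: "nat multiset list \<Rightarrow> opart list set" where
  "overlinings Ms = {\<xi>s. map fst \<xi>s = Ms \<and> (\<forall>\<xi> \<in> set \<xi>s. snd \<xi> \<subseteq> set_mset (fst \<xi>))}"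

lemma overlinings_Nil: "overlinings [] = {[]}"
  by (auto simp: overlinings_def)

lemma overlinings_Cons:
  "overlinings (M # Ms) = (\<lambda>(S, \<xi>s). (M, S) # \<xi>s) ` (Pow (set_mset M) \<times> overlinings Ms)"
proof (intro equalityI subsetI)
  fix \<xi>s assume "\<xi>s \<in> overlinings (M # Ms)"
  then obtain S \<xi>s' where "\<xi>s = (M, S) # \<xi>s'" "S \<subseteq> set_mset M" "\<xi>s' \<in> overlinings Ms"
    by (cases \<xi>s) (auto simp: overlinings_def)
  then show "\<xi>s \<in> (\<lambda>(S, \<xi>s). (M, S) # \<xi>s) ` (Pow (set_mset M) \<times> overlinings Ms)"
    by (intro image_eqI[where x = "(S, \<xi>s')"]) auto
next
  fix \<xi>s assume "\<xi>s \<in> (\<lambda>(S, \<xi>s). (M, S) # \<xi>s) ` (Pow (set_mset M) \<times> overlinings Ms)"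
  then obtain S \<xi>s' where "\<xi>s = (M, S) # \<xi>s'" "S \<subseteq> set_mset M" "\<xi>s' \<in> overlinings Ms"
    by auto
  then show "\<xi>s \<in> overlinings (M # Ms)"
    by (simp add: overlinings_def)
qed

text \<open>Each entry \<open>M\<close> offers the subsets of \<open>set_mset M\<close>,
  independently of the others, so the factors \<open>2 ^ card (set_mset M)\<close> multiply and the
  exponents add. Finiteness is carried along for the later sum over fibres.\<close>

lemma card_overlinings:
  "finite (overlinings Ms) \<and> card (overlinings Ms) = 2 ^ distinct_parts Ms"
proof (induction Ms)
  case Nil
  then show ?case by (simp add: overlinings_Nil distinct_parts_def)
next
  case (Cons M Ms)
  have "inj_on (\<lambda>(S, \<xi>s). (M, S) # \<xi>s) (Pow (set_mset M) \<times> overlinings Ms)"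
    by (auto simp: inj_on_def)
  then show ?case
    using Cons by (simp add: overlinings_Cons card_image card_cartesian_product card_Pow
        distinct_parts_def power_add)
qed

lemma odd_overpartition_tuples_eq:
  "odd_overpartition_tuples k n = (\<Union>Ms \<in> odd_multiset_tuples k n. overlinings Ms)"
proof (intro equalityI subsetI)
  fix \<xi>s assume *: "\<xi>s \<in> odd_overpartition_tuples k n"
  then have "map fst \<xi>s \<in> odd_multiset_tuples k n"
    by (auto simp: odd_overpartition_tuples_def odd_multiset_tuples_def all_parts_odd_def
        weight_def comp_def)
  moreover have "\<xi>s \<in> overlinings (map fst \<xi>s)"
    using * by (auto simp: odd_overpartition_tuples_def overlinings_def overpartition_def)
  ultimately show "\<xi>s \<in> (\<Union>Ms \<in> odd_multiset_tuples k n. overlinings Ms)" by blast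
next
  fix \<xi>s assume "\<xi>s \<in> (\<Union>Ms \<in> odd_multiset_tuples k n. overlinings Ms)"
  then have "map fst \<xi>s \<in> odd_multiset_tuples k n" "\<xi>s \<in> overlinings (map fst \<xi>s)"
    by (auto simp: overlinings_def)
  then show "\<xi>s \<in> odd_overpartition_tuples k n"
    by (fastforce simp: odd_overpartition_tuples_def odd_multiset_tuples_def all_parts_odd_def
        weight_def overlinings_def overpartition_def comp_def)
qed

text \<open>Every tuple of multisets lifts to an overpartition tuple without overlines, so it lies
  in the image under \<open>map fst\<close> of a finite set.\<close>

lemma finite_odd_multiset_tuples: "finite (odd_multiset_tuples k n)"
proof (rule finite_surj[OF finite_odd_overpartition_tuples])
  show "odd_multiset_tuples k n \<subseteq> map fst ` odd_overpartition_tuples k n"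
  proof
    fix Ms assume Ms: "Ms \<in> odd_multiset_tuples k n"
    have "map (\<lambda>M. (M, {})) Ms \<in> overlinings Ms"
      by (auto simp: overlinings_def comp_def)
    then have "map (\<lambda>M. (M, {})) Ms \<in> odd_overpartition_tuples k n"
      using Ms unfolding odd_overpartition_tuples_eq by blast
    then show "Ms \<in> map fst ` odd_overpartition_tuples k n"
      by (rule rev_image_eqI) (simp add: comp_def)
  qed
qed

lemma OPT_eq_sum: "OPT k n = (\<Sum>Ms \<in> odd_multiset_tuples k n. 2 ^ distinct_parts Ms)"
proof -
  have "OPT k n = (\<Sum>Ms \<in> odd_multiset_tuples k n. card (overlinings Ms))"
    unfolding OPT_def odd_overpartition_tuples_eq
    by (intro card_UN_disjoint finite_odd_multiset_tuples)
      \<comment> \<open>The first call settles finiteness of the fibres. The second settles their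
        disjointness: \<open>map fst\<close> recovers \<open>Ms\<close> from any member of its
        fibre.\<close>
      (auto simp: card_overlinings, auto simp: overlinings_def)
  then show ?thesis by (simp add: card_overlinings)
qed

section \<open>Tuples with exactly one distinct part\<close>

lemma distinct_parts_eq_0_iff: "distinct_parts Ms = 0 \<longleftrightarrow> Ms = replicate (length Ms) {#}"
  by (induction Ms) (auto simp: distinct_parts_def)

lemma sum_mset_concat_replicate_empty: "(\<Sum>M\<leftarrow>replicate k {#}. \<Sum>\<^sub># M) = (0 :: nat)"
  by (induction k) auto

lemma card_set_mset_eq_1:
  assumes "card (set_mset M) = 1"
  obtains d c where "M = replicate_mset c d" "c > 0"
proof -
  from assms obtain d where d: "set_mset M = {d}" by (auto simp: card_1_singleton_iff)
  then have "M = replicate_mset (count M d) d"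
    by (intro multiset_eqI) (metis count_replicate_mset not_in_iff singletonD)
  moreover have "count M d > 0" using d by auto
  ultimately show thesis using that by blast
qed

lemma dvd_div_pos:
  fixes d n :: nat
  assumes "d dvd n" and "n > 0"
  shows "n div d > 0"
  using assms by (metis dvd_div_eq_0_iff neq0_conv)

text \<open>A multiset with one distinct part is \<open>c\<close> copies of some \<open>d\<close>.
  The sum \<open>c * d = n\<close> forces \<open>d\<close> to divide \<open>n\<close> and fixes
  \<open>c = n div d\<close>.\<close>

lemma odd_constant_multisets_eq:
  fixes n :: nat
  assumes "n > 0"
  shows "{M. card (set_mset M) = 1 \<and> (\<forall>x \<in># M. odd x) \<and> \<Sum>\<^sub># M = n}
    = (\<lambda>d. replicate_mset (n div d) d) ` {d. d dvd n \<and> odd d}" (is "?A = ?f ` ?B")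
proof (intro equalityI subsetI)
  fix M assume M: "M \<in> ?A"
  then have "card (set_mset M) = 1" by simp
  then obtain d c where dc: "M = replicate_mset c d" "c > 0"
    by (rule card_set_mset_eq_1)
  from M have "\<forall>x \<in># M. odd x" "\<Sum>\<^sub># M = n" by simp_all
  with dc have d: "odd d" "c * d = n" by (simp_all add: dc)
  then have "n div d = c" using odd_pos by auto
  then have "M = ?f d" using dc(1) by simp
  moreover have "d \<in> ?B" using d by auto
  ultimately show "M \<in> ?f ` ?B" by (rule image_eqI)
next
  fix M assume "M \<in> ?f ` ?B"
  then obtain d where d: "d dvd n" "odd d" "M = replicate_mset (n div d) d" by blast
  then have "n div d > 0" using assms by (simp add: dvd_div_pos)
  with d(2) have "card (set_mset M) = 1" "\<forall>x \<in># M. odd x" by (simp_all add: d(3))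
  moreover have "\<Sum>\<^sub># M = n" using d(1) by (simp add: d(3))
  ultimately show "M \<in> ?A" by simp
qed

lemma card_odd_constant_multisets:
  fixes n :: nat
  assumes "n > 0"
  shows "card {M. card (set_mset M) = 1 \<and> (\<forall>x \<in># M. odd x) \<and> \<Sum>\<^sub># M = n}
    = card {d. d dvd n \<and> odd d}"
proof -
  have "inj_on (\<lambda>d. replicate_mset (n div d) d) {d. d dvd n \<and> odd d}"
  proof (rule inj_onI)
    fix d e assume "d \<in> {d. d dvd n \<and> odd d}" "e \<in> {d. d dvd n \<and> odd d}"
      and eq: "replicate_mset (n div d) d = replicate_mset (n div e) e"
    then have "n div d > 0" "n div e > 0" using assms by (simp_all add: dvd_div_pos)
    with arg_cong[OF eq, of set_mset] show "d = e" by simp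
  qed
  then show ?thesis
    unfolding odd_constant_multisets_eq[OF assms] by (rule card_image)
qed

text \<open>Induction on \<open>k\<close>: the single nonempty entry is either the head, which is
  then a constant multiset followed by empty ones, or it lies in the tail behind an empty
  head.\<close>

lemma card_one_distinct_part:
  assumes "n > 0"
  shows "card {Ms \<in> odd_multiset_tuples k n. distinct_parts Ms = 1}
    = k * card {d. d dvd n \<and> odd d}"
proof (induction k)
  case 0
  then show ?case by (simp add: odd_multiset_tuples_def distinct_parts_def)
next
  case (Suc k)
  let ?W = "\<lambda>k. {Ms \<in> odd_multiset_tuples k n. distinct_parts Ms = 1}"
  let ?C = "{M. card (set_mset M) = 1 \<and> (\<forall>x \<in># M. odd x) \<and> \<Sum>\<^sub># M = n}"
  let ?h = "\<lambda>M. M # replicate k {#}"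
  have split: "?W (Suc k) = ?h ` ?C \<union> (#) {#} ` ?W k"
  proof (intro equalityI subsetI)
    fix Ms assume Ms: "Ms \<in> ?W (Suc k)"
    then obtain M Ms' where eq: "Ms = M # Ms'" "length Ms' = k"
      by (cases Ms) (auto simp: odd_multiset_tuples_def)
    then consider "card (set_mset M) = 1" "distinct_parts Ms' = 0"
      | "M = {#}" "distinct_parts Ms' = 1"
      using Ms by (auto simp: distinct_parts_def add_is_1)
    then show "Ms \<in> ?h ` ?C \<union> (#) {#} ` ?W k"
    proof cases
      case 1
      then have "Ms' = replicate k {#}" using eq distinct_parts_eq_0_iff by metis
      then show ?thesis
        using 1 eq Ms by (auto simp: odd_multiset_tuples_def sum_mset_concat_replicate_empty)
    next
      case 2
      then show ?thesis using eq Ms by (auto simp: odd_multiset_tuples_def)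
    qed
  next
    fix Ms assume "Ms \<in> ?h ` ?C \<union> (#) {#} ` ?W k"
    moreover have "distinct_parts (replicate k {#}) = 0" by (simp add: distinct_parts_eq_0_iff)
    ultimately show "Ms \<in> ?W (Suc k)"
      by (auto simp: odd_multiset_tuples_def distinct_parts_def sum_mset_concat_replicate_empty)
  qed
  have "finite ?C"
    unfolding odd_constant_multisets_eq[OF assms] using assms by simp
  moreover have "finite (?W k)" by (simp add: finite_odd_multiset_tuples)
  \<comment> \<open>Members of \<open>?C\<close> are nonempty, so the heads differ.\<close>
  moreover have "?h ` ?C \<inter> (#) {#} ` ?W k = {}" by auto
  ultimately have "card (?W (Suc k)) = card (?h ` ?C) + card ((#) {#} ` ?W k)"
    unfolding split by (intro card_Un_disjoint) auto
  also have "card (?h ` ?C) = card ?C" by (rule card_image) (auto simp: inj_on_def)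
  also have "card ((#) {#} ` ?W k) = card (?W k)" by (rule card_image) (auto simp: inj_on_def)
  finally show ?case
    using Suc card_odd_constant_multisets[OF assms] by simp
qed

theorem OPT_cong_odd_divisors:
  assumes "n > 0"
  shows "[OPT k n = 2 * k * card {d. d dvd n \<and> odd d}] (mod 4)"
proof -
  let ?T = "odd_multiset_tuples k n"
  have "[(2::nat) ^ distinct_parts Ms = (if distinct_parts Ms = 1 then 2 else 0)] (mod 4)"
    if "Ms \<in> ?T" for Ms
  proof -
    \<comment> \<open>The exponent 0 would contribute 1, but it belongs only to the tuple of empty
      multisets, whose sum is 0 and not \<open>n\<close>.\<close>
    have "distinct_parts Ms \<noteq> 0"
    proof
      assume "distinct_parts Ms = 0"
      then have "(\<Sum>M\<leftarrow>Ms. \<Sum>\<^sub># M) = 0"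
        by (metis distinct_parts_eq_0_iff sum_mset_concat_replicate_empty)
      with that assms show False by (simp add: odd_multiset_tuples_def)
    qed
    moreover have "4 dvd (2::nat) ^ w" if "w \<ge> 2" for w
      using le_imp_power_dvd[OF that, of "2::nat"] by simp
    ultimately show ?thesis by (auto simp: cong_0_iff)
  qed
  then have "[OPT k n = (\<Sum>Ms \<in> ?T. if distinct_parts Ms = 1 then 2 else 0)] (mod 4)"
    unfolding OPT_eq_sum by (rule cong_sum)
  also have "(\<Sum>Ms \<in> ?T. if distinct_parts Ms = 1 then 2 else 0)
      = 2 * card {Ms \<in> ?T. distinct_parts Ms = 1}"
    by (simp add: finite_odd_multiset_tuples flip: sum.inter_filter)
  finally show ?thesis by (simp only: card_one_distinct_part[OF assms] mult.assoc)
qed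

section \<open>Parity of the number of divisors\<close>

lemma even_card_divisors:
  fixes m :: nat
  assumes "m > 0" and "\<And>s. m \<noteq> s\<^sup>2"
  shows "even (card {d. d dvd m})"
proof -
  let ?L = "{d. d dvd m \<and> d * d < m}" and ?G = "{d. d dvd m \<and> d * d > m}"
  have fin: "finite {d. d dvd m}" using assms(1) by simp
  \<comment> \<open>Passing to the complementary divisor is an involution that exchanges the
    divisors below the square root of \<open>m\<close> with those above it.\<close>
  have compl: "m div d dvd m \<and> m div (m div d) = d
      \<and> (d * d < m \<longrightarrow> m div d * (m div d) > m) \<and> (d * d > m \<longrightarrow> m div d * (m div d) < m)"
    if "d dvd m" for d
  proof -
    from that obtain e where e: "m = d * e" by (elim dvdE)
    with assms(1) have "d > 0" "e > 0" by auto
    then show ?thesis by (simp add: e)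
  qed
  have "bij_betw (\<lambda>d. m div d) ?L ?G"
    by (rule bij_betw_byWitness[where f' = "\<lambda>d. m div d"])
      (use compl in blast)+
  then have "card ?L = card ?G" by (rule bij_betw_same_card)
  \<comment> \<open>No divisor is left between \<open>?L\<close> and \<open>?G\<close>: one with
    \<open>d * d = m\<close> would make \<open>m\<close> a square.\<close>
  moreover have "{d. d dvd m} = ?L \<union> ?G"
    using assms(2) by (auto simp: power2_eq_square) (metis nat_neq_iff)
  moreover have "card (?L \<union> ?G) = card ?L + card ?G"
    by (rule card_Un_disjoint) (auto intro: finite_subset[OF _ fin])
  ultimately have "card {d. d dvd m} = card ?G + card ?G" by presburger
  then show ?thesis by simp
qed

text \<open>The odd divisors of \<open>n = 2 ^ a * m\<close> with \<open>m\<close> odd are the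
  divisors of \<open>m\<close>. If \<open>m\<close> were a square, then \<open>n\<close> would be a
  square for even \<open>a\<close> and twice a square for odd \<open>a\<close>.\<close>

lemma even_card_odd_divisors:
  fixes n :: nat
  assumes "n > 0" and "\<And>s. n \<noteq> s\<^sup>2" and "\<And>s. n \<noteq> 2 * s\<^sup>2"
  shows "even (card {d. d dvd n \<and> odd d})"
proof -
  from assms(1) obtain a m where n: "n = 2 ^ a * m" and m: "odd m"
    using multiplicity_decompose'[of n 2]
    by (metis gr_implies_not0 nat_dvd_1_iff_1 numeral_eq_one_iff semiring_norm(85))
  have "d dvd n \<longleftrightarrow> d dvd m" if "odd d" for d
  proof -
    from that have "coprime d (2 ^ a)" by simp
    then show ?thesis unfolding n by (rule coprime_dvd_mult_right_iff)
  qed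
  moreover have "odd d" if "d dvd m" for d using that m dvd_trans by blast
  ultimately have "{d. d dvd n \<and> odd d} = {d. d dvd m}" by blast
  moreover have "m \<noteq> s\<^sup>2" for s
  proof
    assume s: "m = s\<^sup>2"
    show False
    proof (cases "even a")
      case True
      then obtain b where "a = 2 * b" by blast
      then have "n = (2 ^ b * s)\<^sup>2" by (simp add: n s power_mult_distrib power_even_eq)
      with assms(2) show False by blast
    next
      case False
      then obtain b where "a = 2 * b + 1" by (blast elim: oddE)
      then have "n = 2 * (2 ^ b * s)\<^sup>2" by (simp add: n s power_mult_distrib power_even_eq)
      with assms(3) show False by blast
    qed
  qed
  moreover have "m > 0" using m by (simp add: odd_pos)
  ultimately show ?thesis using even_card_divisors by metis
qed

section \<open>Residues of the argument modulo 3 and modulo p\<close>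

theorem theorem1p3:
  fixes p r A R n :: nat
  assumes "prime p" and "p \<ge> 5"
    and "r > 0" and "\<not> p dvd r" and "\<not> QuadRes (int p) (int r)"
    and "A \<in> {0, 1, 2}" and "[A * p = 2 * r + 1] (mod 3)"
    and "R = (if 2 * (A * p + r) < 3 * p then 2 * (A * p + r) else 2 * (A * p + r) - 3 * p)"
  shows "[OPT 3 (3 * p * n + R) = 0] (mod 4)"
proof -
  define N where "N = 3 * p * n + R"
  \<comment> \<open>Adding \<open>3 * p\<close> undoes the possible subtraction in \<open>R\<close>
    and changes neither residue, so both cases share one equation: \<open>t\<close> is
    \<open>Suc n\<close> without the subtraction and \<open>n\<close> with it.\<close>
  obtain t where t: "N + 3 * p = 3 * p * t + 2 * (A * p + r)"
  proof (cases "2 * (A * p + r) < 3 * p")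
    case True
    then show ?thesis using assms(8) by (intro that[of "Suc n"]) (simp add: N_def)
  next
    case False
    then show ?thesis using assms(8) by (intro that[of n]) (simp add: N_def)
  qed
  \<comment> \<open>The choice of \<open>A\<close> turns \<open>A * p + r\<close> into
    \<open>3 * r + 1\<close> modulo 3, hence its double into 2.\<close>
  have E3: "[2 * (A * p + r) = 2 * (2 * r + 1 + r)] (mod 3)"
    using assms(7) by (intro cong_mult cong_add cong_refl)
  have "N mod 3 = (N + 3 * p) mod 3" by simp
  also have "\<dots> = (2 * (A * p + r)) mod 3" by (simp add: t mult.assoc)
  also have "\<dots> = (2 + 3 * (2 * r)) mod 3" using E3 by (simp add: cong_def)
  also have "\<dots> = 2" by (simp only: mod_mult_self2) simp
  finally have N3: "N mod 3 = 2" .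
  have "N mod p = (N + 3 * p) mod p" by simp
  also have "N + 3 * p = 2 * r + p * (3 * t + 2 * A)" unfolding t by (simp add: algebra_simps)
  finally have Np: "[N = 2 * r] (mod p)" by (simp add: cong_def)
  have "N \<noteq> s\<^sup>2" for s
  proof
    assume "N = s\<^sup>2"
    \<comment> \<open>The squares modulo 3 are only 0 and 1.\<close>
    then have "(s mod 3)\<^sup>2 mod 3 = 2" using N3 by (simp add: power_mod)
    moreover have "s mod 3 \<in> {0, 1, 2}" by auto
    ultimately show False by auto
  qed
  moreover have "N \<noteq> 2 * s\<^sup>2" for s
  proof
    assume "N = 2 * s\<^sup>2"
    then have "[2 * s\<^sup>2 = 2 * r] (mod p)" using Np by simp
    \<comment> \<open>Since \<open>p\<close> is an odd prime, the factor 2 cancels and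
      \<open>r\<close> would become a square modulo \<open>p\<close>.\<close>
    moreover have "coprime 2 p"
      using assms(1,2) by (intro primes_coprime) auto
    ultimately have "[s\<^sup>2 = r] (mod p)" by (simp add: cong_mult_lcancel_nat)
    then have "[(int s)\<^sup>2 = int r] (mod int p)" by (metis cong_int_iff of_nat_power)
    with assms(5) show False by (auto simp: QuadRes_def)
  qed
  moreover have "N > 0" using N3 by (intro gr0I) simp
  ultimately have "even (card {d. d dvd N \<and> odd d})"
    by (intro even_card_odd_divisors)
  then have "[2 * 3 * card {d. d dvd N \<and> odd d} = 0] (mod 4)"
    by (auto simp: cong_0_iff elim!: evenE)
  with OPT_cong_odd_divisors[OF \<open>N > 0\<close>, of 3] show ?thesis
    unfolding N_def by (rule cong_trans)
qed

end
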